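(* Let $E_1,E_2$ be real Banach spaces, let $C\subset E_1$ and $Q\subset E_2$ be nonempty, closed and convex, let $A:E_1\to E_2$ be a bounded linear operator, and let $f:E_1\times E_1\to\mathbb{R}$ and $g:E_2\times E_2\to\mathbb{R}$ be bifunctions. Let $N$ be a finite-dimensional normed space, let $M\subset N$ be a closed ball centered at $p^*$ with positive radius, and let $\tilde f:M\times E_1\times E_1\to\mathbb{R}$ and $\tilde g:M\times E_2\times E_2\to\mathbb{R}$ be functions with $\tilde f(p^*,\cdot,\cdot)=f$ and $\tilde g(p^*,\cdot,\cdot)=g$, such that $\tilde f(\cdot,\cdot,x)$ and $\tilde g(\cdot,\cdot,y)$ are upper semi-continuous for each $(x,y)\in E_1\times E_2$. Then the split equilibrium problem $SEP(f,g,C,Q)$ is LP well-posed by perturbations in the generalized sense if and only if $$S(\epsilon)\neq\emptyset\quad\forall\,\epsilon>0\qquad\text{and}\qquad \mu(S(\epsilon))\to 0\ \text{ as }\ \epsilon\to 0,$$ where $\mu$ denotes the Kuratowski measure of noncompactness.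
   Context: The split equilibrium problem $SEP(f,g,C,Q)$ is: find $(x^*,y^* )\in E_1\times E_2$ such that $x^*\in C$, $y^*\in Q$, $y^*=Ax^*$, $f(x^*,x)\ge 0$ for all $x\in C$, and $g(y^*,y)\ge 0$ for all $y\in Q$. Its solution set is denoted by $S$. The space $E_1\times E_2$ carries a standard product norm (e.g. $\|(x,y)\|=\|x\|+\|y\|$). Upper semi-continuity: a real function $h$ of two variables is upper semi-continuous at $(u,v)$ if $\limsup_{n\to\infty}h(u_n,v_n)\le h(u,v)$ for every sequence $(u_n,v_n)\to(u,v)$ in its domain; it is upper semi-continuous if this holds at every point of its domain (jointly in both variables). Generalized approximating sequence: let $\{p_n\}\subset M$ with $p_n\to p^*$. A sequence $\{(x_n,y_n)\}$ in $E_1\times E_2$ is a generalized approximating sequence corresponding to $\{p_n\}$ for $SEP(f,g,C,Q)$ if there exists a sequence of positive numbers $\epsilon_n\to 0$ such that, for every $n$, $d(x_n,C)\le\epsilon_n$, $d(y_n,Q)\le\epsilon_n$, $\|y_n-Ax_n\|\le\epsilon_n$, $\tilde f(p_n,x_n,x)\ge-\epsilon_n$ for all $x\in C$, and $\tilde g(p_n,y_n,y)\ge-\epsilon_n$ for all $y\in Q$. Here $d(a,B)=\inf_{b\in B}\|a-b\|$. LP (Levitin-Polyak) well-posedness by perturbations in the generalized sense: $SEP(f,g,C,Q)$ is LP well-posed by perturbations in the generalized sense if $S\ne\emptyset$ and, for any $\{p_n\}\subset M$ with $p_n\to p^*$, every generalized approximating sequence corresponding to $\{p_n\}$ has a subsequence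 which converges to some element of $S$. Approximate solution set: for $\epsilon\ge 0$, $S(\epsilon)$ is the set of all $(z,w)\in E_1\times E_2$ for which there is $p\in M$ with $\|p-p^*\|\le\epsilon$ such that $d(z,C)\le\epsilon$, $d(w,Q)\le\epsilon$, $\|w-Az\|\le\epsilon$, $\tilde f(p,z,x)\ge-\epsilon$ for all $x\in C$, and $\tilde g(p,w,y)\ge-\epsilon$ for all $y\in Q$. Kuratowski measure of noncompactness: $\mu(B)=\inf\{\epsilon>0: B\subset\bigcup_{i=1}^n B_i,\ \operatorname{diam}(B_i)<\epsilon,\ i=1,\dots,n,\ n\in\mathbb{N}\}$ (with $\inf\emptyset=+\infty$), i.e. the infimum of those $\epsilon>0$ for which $B$ can be covered by finitely many sets of diameter less than $\epsilon$, where $\operatorname{diam}(B)=\sup\{\|u-v\|:u,v\in B\}$. *)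

theory Defs
  imports "HOL-Analysis.Analysis"
begin

definition usc_on :: "'a::topological_space set \<Rightarrow> ('a \<Rightarrow> real) \<Rightarrow> bool" where
  "usc_on D h \<longleftrightarrow>
     (\<forall>w\<in>D. \<forall>s. (\<forall>n. s n \<in> D) \<longrightarrow> s \<longlonglongrightarrow> w \<longrightarrow>
        limsup (\<lambda>n. ereal (h (s n))) \<le> ereal (h w))"

(* The library's diameter is meaningful only on bounded sets (on an unbounded set it is a
   supremum of an unbounded set of reals, where diam should be infinite), hence the
   boundedness condition.  The value is PInfty when there is no such cover. *)
definition kuratowski_measure :: "'a::metric_space set \<Rightarrow> ereal" where
  "kuratowski_measure B =
     Inf (ereal ` {\<epsilon>. \<epsilon> > 0 \<and>
       (\<exists>\<B>. finite \<B> \<and> B \<subseteq> \<Union>\<B> \<and> (\<forall>D\<in>\<B>. bounded D \<and> diameter D < \<epsilon>))})"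

definition sep_solutions ::
  "('a::real_normed_vector \<Rightarrow> 'a \<Rightarrow> real) \<Rightarrow> ('b::real_normed_vector \<Rightarrow> 'b \<Rightarrow> real) \<Rightarrow>
   'a set \<Rightarrow> 'b set \<Rightarrow> ('a \<Rightarrow> 'b) \<Rightarrow> ('a \<times> 'b) set" where
  "sep_solutions f g C Q A =
     {(x', y'). x' \<in> C \<and> y' \<in> Q \<and> y' = A x' \<and>
        (\<forall>x\<in>C. f x' x \<ge> 0) \<and> (\<forall>y\<in>Q. g y' y \<ge> 0)}"

(* F and G are the perturbed bifunctions (tilde f and tilde g); only their values at
   parameters p in M matter.  infdist z C is the distance d(z,C) for nonempty C. *)
definition sep_gen_approx_seq ::
  "('n::real_normed_vector \<Rightarrow> 'a::real_normed_vector \<Rightarrow> 'a \<Rightarrow> real) \<Rightarrow>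
   ('n \<Rightarrow> 'b::real_normed_vector \<Rightarrow> 'b \<Rightarrow> real) \<Rightarrow>
   'a set \<Rightarrow> 'b set \<Rightarrow> ('a \<Rightarrow> 'b) \<Rightarrow> (nat \<Rightarrow> 'n) \<Rightarrow> (nat \<Rightarrow> 'a) \<Rightarrow> (nat \<Rightarrow> 'b) \<Rightarrow> bool" where
  "sep_gen_approx_seq F G C Q A p x y \<longleftrightarrow>
     (\<exists>\<epsilon>. (\<forall>n. \<epsilon> n > 0) \<and> \<epsilon> \<longlonglongrightarrow> 0 \<and>
       (\<forall>n. infdist (x n) C \<le> \<epsilon> n \<and> infdist (y n) Q \<le> \<epsilon> n \<and>
            norm (y n - A (x n)) \<le> \<epsilon> n \<and>
            (\<forall>u\<in>C. F (p n) (x n) u \<ge> - \<epsilon> n) \<and>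
            (\<forall>v\<in>Q. G (p n) (y n) v \<ge> - \<epsilon> n)))"

definition sep_LP_well_posed ::
  "('a::real_normed_vector \<Rightarrow> 'a \<Rightarrow> real) \<Rightarrow> ('b::real_normed_vector \<Rightarrow> 'b \<Rightarrow> real) \<Rightarrow>
   'a set \<Rightarrow> 'b set \<Rightarrow> ('a \<Rightarrow> 'b) \<Rightarrow>
   'n::real_normed_vector set \<Rightarrow> 'n \<Rightarrow>
   ('n \<Rightarrow> 'a \<Rightarrow> 'a \<Rightarrow> real) \<Rightarrow> ('n \<Rightarrow> 'b \<Rightarrow> 'b \<Rightarrow> real) \<Rightarrow> bool" where
  "sep_LP_well_posed f g C Q A M pstar F G \<longleftrightarrow>
     sep_solutions f g C Q A \<noteq> {} \<and>
     (\<forall>p x y. (\<forall>n. p n \<in> M) \<longrightarrow> p \<longlonglongrightarrow> pstar \<longrightarrow> sep_gen_approx_seq F G C Q A p x y \<longrightarrow>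
        (\<exists>r z. strict_mono r \<and> z \<in> sep_solutions f g C Q A \<and>
               (\<lambda>n. (x (r n), y (r n))) \<longlonglongrightarrow> z))"

definition sep_approx_solutions ::
  "'a::real_normed_vector set \<Rightarrow> 'b::real_normed_vector set \<Rightarrow> ('a \<Rightarrow> 'b) \<Rightarrow>
   'n::real_normed_vector set \<Rightarrow> 'n \<Rightarrow>
   ('n \<Rightarrow> 'a \<Rightarrow> 'a \<Rightarrow> real) \<Rightarrow> ('n \<Rightarrow> 'b \<Rightarrow> 'b \<Rightarrow> real) \<Rightarrow> real \<Rightarrow> ('a \<times> 'b) set" where
  "sep_approx_solutions C Q A M pstar F G \<epsilon> =
     {(z, w). \<exists>p\<in>M. norm (p - pstar) \<le> \<epsilon> \<and>
        infdist z C \<le> \<epsilon> \<and> infdist w Q \<le> \<epsilon> \<and> norm (w - A z) \<le> \<epsilon> \<and>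
        (\<forall>x\<in>C. F p z x \<ge> - \<epsilon>) \<and> (\<forall>y\<in>Q. G p w y \<ge> - \<epsilon>)}"

end

theory Submission
  imports Defs
begin

text \<open>
  A sequence with \<open>u\<^sub>n \<in> S(\<epsilon>\<^sub>n)\<close> and \<open>\<epsilon>\<^sub>n \<rightarrow> 0\<close> is the same thing as a generalized approximating
  sequence, and by upper semi-continuity the limits of its subsequences lie in \<open>S\<close>.
  If \<open>\<mu>(S(\<epsilon>)) \<rightarrow> 0\<close>, such a sequence is eventually covered by finitely many balls of any given
  radius, so it has a convergent subsequence by completeness. Conversely, well-posedness makes \<open>S\<close>
  compact and, by contradiction, puts \<open>S(\<epsilon>)\<close> inside any prescribed neighbourhood of \<open>S\<close>; a finite
  net of \<open>S\<close> then covers \<open>S(\<epsilon>)\<close>.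
\<close>

section \<open>Kuratowski measure and finite ball covers\<close>

text \<open>Each covering set lies in the ball of radius \<open>e\<close> around any one of its
  points, because its diameter is below some \<open>d < e\<close>.\<close>

lemma finite_ball_cover_if_kuratowski_measure_less:
  fixes B :: "'a::metric_space set"
  assumes "kuratowski_measure B < ereal e"
  obtains K where "finite K" "B \<subseteq> (\<Union>x\<in>K. ball x e)"
proof -
  obtain d \<B> where d: "d < e" "finite \<B>" "B \<subseteq> \<Union>\<B>"
    and \<B>: "\<And>D. D \<in> \<B> \<Longrightarrow> bounded D \<and> diameter D < d"
    using assms unfolding kuratowski_measure_def Inf_less_iff by auto
  \<comment> \<open>For empty \<open>D\<close> this point is arbitrary; its ball merely enlarges the
    cover.\<close>
  define c where "c D = (SOME x. x \<in> D)" for D :: "'a set"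
  have "B \<subseteq> (\<Union>x\<in>c ` \<B>. ball x e)"
  proof
    fix y assume "y \<in> B"
    then obtain D where D: "D \<in> \<B>" "y \<in> D" using d(3) by blast
    then have "c D \<in> D" unfolding c_def by (intro someI)
    then have "dist (c D) y \<le> diameter D"
      using D \<B> by (intro diameter_bounded_bound) auto
    then have "y \<in> ball (c D) e" using \<B>[OF D(1)] d(1) by simp
    then show "y \<in> (\<Union>x\<in>c ` \<B>. ball x e)" using D(1) by blast
  qed
  with \<open>finite \<B>\<close> show ?thesis by (intro that[of "c ` \<B>"]) auto
qed

text \<open>A ball of radius \<open>e\<close> has diameter at most \<open>2 * e\<close>; the factor
  3 leaves room for the strict inequality in the definition of the measure.\<close>

lemma kuratowski_measure_le_if_ball_cover:
  fixes B :: "'a::metric_space set"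
  assumes "finite K" "B \<subseteq> (\<Union>x\<in>K. ball x e)" "e > 0"
  shows "kuratowski_measure B \<le> ereal (3 * e)"
proof -
  have "diameter (ball x e) < 3 * e" for x :: 'a
  proof -
    have "diameter (ball x e) \<le> 2 * e"
    proof -
      have "dist u v \<le> 2 * e" if "u \<in> ball x e" "v \<in> ball x e" for u v
        using that dist_triangle2[of u v x] by (simp add: dist_commute)
      then show ?thesis
        using \<open>e > 0\<close> unfolding diameter_def by (auto intro!: cSUP_least)
    qed
    with \<open>e > 0\<close> show ?thesis by simp
  qed
  then show ?thesis
    unfolding kuratowski_measure_def using assms
    by (intro Inf_lower imageI) (auto intro!: exI[of _ "(\<lambda>x. ball x e) ` K"])
qed

lemma kuratowski_measure_nonneg: "kuratowski_measure B \<ge> 0"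
  unfolding kuratowski_measure_def by (intro Inf_greatest) auto

text \<open>The range is totally bounded, since the finitely many terms outside a cover can be
  covered separately; by completeness its closure is compact.\<close>

lemma convergent_subseq_if_eventually_ball_cover:
  fixes s :: "nat \<Rightarrow> 'a::complete_space"
  assumes "\<And>e. e > 0 \<Longrightarrow> \<exists>K. finite K \<and> (\<forall>\<^sub>F n in sequentially. s n \<in> (\<Union>x\<in>K. ball x e))"
  obtains r l where "strict_mono (r :: nat \<Rightarrow> nat)" "(s \<circ> r) \<longlonglongrightarrow> l"
proof -
  have "compact (closure (range s))"
    unfolding compact_eq_totally_bounded
  proof (intro conjI allI impI)
    show "complete (closure (range s))" by (simp add: complete_eq_closed)
    fix e :: real assume "e > 0"
    then obtain K where "finite K" and "\<forall>\<^sub>F n in sequentially. s n \<in> (\<Union>x\<in>K. ball x (e/2))"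
      using assms[of "e/2"] by auto
    then obtain N where N: "\<And>n. n \<ge> N \<Longrightarrow> s n \<in> (\<Union>x\<in>K. ball x (e/2))"
      by (auto simp: eventually_sequentially)
    \<comment> \<open>The first \<open>N\<close> terms, possibly missed by the cover, become centres
      of their own balls.\<close>
    define L where "L = K \<union> s ` {..<N}"
    have "finite L" using \<open>finite K\<close> by (simp add: L_def)
    have "s n \<in> (\<Union>x\<in>L. cball x (e/2))" for n
    proof (cases "n < N")
      case True
      then have "s n \<in> L" by (simp add: L_def)
      then show ?thesis using \<open>e > 0\<close> by (auto intro!: bexI[of _ "s n"])
    next
      case False
      then have "s n \<in> (\<Union>x\<in>K. ball x (e/2))" by (intro N) simp
      then show ?thesis unfolding L_def by (auto intro: less_imp_le)
    qed
    \<comment> \<open>A finite union of closed balls is closed and so absorbs the closure; halving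
      the radius lets these balls fit into open balls of radius \<open>e\<close>.\<close>
    then have "closure (range s) \<subseteq> (\<Union>x\<in>L. cball x (e/2))"
      using \<open>finite L\<close> by (intro closure_minimal closed_UN) auto
    also have "\<dots> \<subseteq> (\<Union>x\<in>L. ball x e)" using \<open>e > 0\<close> by (intro UN_mono) auto
    finally show "\<exists>k. finite k \<and> closure (range s) \<subseteq> (\<Union>x\<in>k. ball x e)"
      using \<open>finite L\<close> by blast
  qed
  then have "seq_compact (closure (range s))" by (simp add: compact_eq_seq_compact_metric)
  moreover have "\<forall>n. s n \<in> closure (range s)"
    using closure_subset[of "range s"] by auto
  ultimately show ?thesis by (rule seq_compactE) (rule that)
qed

section \<open>Passing to the limit in the defining conditions\<close>

text \<open>The limsup of \<open>h (s n)\<close> is squeezed between 0, the limit of the lower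
  bounds \<open>- e n\<close>, and \<open>h w\<close>, its upper bound by semi-continuity.\<close>

lemma usc_on_limit_ge:
  assumes "usc_on D h" "w \<in> D" "\<And>n. s n \<in> D" "s \<longlonglongrightarrow> w"
    and "\<And>n. h (s n) \<ge> - e n" "e \<longlonglongrightarrow> 0"
  shows "h w \<ge> 0"
proof -
  have "(\<lambda>n. ereal (- e n)) \<longlonglongrightarrow> ereal (- 0)"
    by (intro tendsto_intros assms)
  then have "limsup (\<lambda>n. ereal (- e n)) = 0"
    by (simp add: lim_imp_Limsup zero_ereal_def)
  moreover have "limsup (\<lambda>n. ereal (- e n)) \<le> limsup (\<lambda>n. ereal (h (s n)))"
    using assms(5) by (intro Limsup_mono) auto
  moreover have "limsup (\<lambda>n. ereal (h (s n))) \<le> ereal (h w)"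
    using assms(1-4) unfolding usc_on_def by blast
  ultimately show ?thesis using order_trans[of 0 _ "ereal (h w)"] by fastforce
qed

lemma infdist_limit_in_closed:
  assumes "closed C" "C \<noteq> {}" "x \<longlonglongrightarrow> z" "\<And>n. infdist (x n) C \<le> e n" "e \<longlonglongrightarrow> (0::real)"
  shows "z \<in> C"
proof -
  have "infdist z C \<le> 0"
    using LIMSEQ_le[OF tendsto_infdist[OF assms(3)] assms(5)] assms(4) by blast
  then show ?thesis
    using in_closed_iff_infdist_zero[OF assms(1,2)] infdist_nonneg[of z C] by simp
qed

section \<open>Approximate solution sets versus generalized approximating sequences\<close>

lemma sep_approx_solutions_mono:
  "\<delta> \<le> \<epsilon> \<Longrightarrow> sep_approx_solutions C Q A M pstar F G \<delta> \<subseteq> sep_approx_solutions C Q A M pstar F G \<epsilon>"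
  unfolding sep_approx_solutions_def
  by clarify (intro bexI conjI ballI; force)

lemma sep_solutions_subset_approx_solutions:
  assumes "pstar \<in> M" "\<epsilon> \<ge> 0"
  shows "sep_solutions (F pstar) (G pstar) C Q A \<subseteq> sep_approx_solutions C Q A M pstar F G \<epsilon>"
proof clarify
  fix z w assume "(z, w) \<in> sep_solutions (F pstar) (G pstar) C Q A"
  with assms show "(z, w) \<in> sep_approx_solutions C Q A M pstar F G \<epsilon>"
    unfolding sep_solutions_def sep_approx_solutions_def
    by clarify (intro bexI[of _ pstar] conjI ballI; force)
qed

text \<open>Each membership hides a parameter within \<epsilon> n of \<open>pstar\<close>; choosing
  one for every \<open>n\<close> yields a parameter sequence that must converge to
  \<open>pstar\<close>.\<close>

lemma sep_gen_approx_seq_if_in_approx_solutions: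
  assumes "\<And>n. \<epsilon> n > 0" "\<epsilon> \<longlonglongrightarrow> 0"
    and "\<And>n. (x n, y n) \<in> sep_approx_solutions C Q A M pstar F G (\<epsilon> n)"
  obtains p where "\<And>n. p n \<in> M" "p \<longlonglongrightarrow> pstar" "sep_gen_approx_seq F G C Q A p x y"
proof -
  have "\<exists>p. p \<in> M \<and> norm (p - pstar) \<le> \<epsilon> n \<and>
        infdist (x n) C \<le> \<epsilon> n \<and> infdist (y n) Q \<le> \<epsilon> n \<and> norm (y n - A (x n)) \<le> \<epsilon> n \<and>
        (\<forall>u\<in>C. F p (x n) u \<ge> - \<epsilon> n) \<and> (\<forall>v\<in>Q. G p (y n) v \<ge> - \<epsilon> n)" for n
    using assms(3)[of n] unfolding sep_approx_solutions_def by auto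
  then obtain p where p: "\<And>n. p n \<in> M \<and> norm (p n - pstar) \<le> \<epsilon> n \<and>
        infdist (x n) C \<le> \<epsilon> n \<and> infdist (y n) Q \<le> \<epsilon> n \<and> norm (y n - A (x n)) \<le> \<epsilon> n \<and>
        (\<forall>u\<in>C. F (p n) (x n) u \<ge> - \<epsilon> n) \<and> (\<forall>v\<in>Q. G (p n) (y n) v \<ge> - \<epsilon> n)"
    by metis
  have "(\<lambda>n. p n - pstar) \<longlonglongrightarrow> 0"
    by (rule Lim_null_comparison[OF _ assms(2)]) (simp add: p)
  then have "p \<longlonglongrightarrow> pstar" by (rule LIM_zero_cancel)
  moreover have "sep_gen_approx_seq F G C Q A p x y"
    unfolding sep_gen_approx_seq_def using assms(1,2) p by (intro exI[of _ \<epsilon>]) simp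
  ultimately show ?thesis using p by (intro that[of p]) simp_all
qed

lemma in_approx_solutions_if_sep_gen_approx_seq:
  assumes "\<And>n. p n \<in> M" "p \<longlonglongrightarrow> pstar" "sep_gen_approx_seq F G C Q A p x y"
    and "\<epsilon> > 0"
  shows "\<forall>\<^sub>F n in sequentially. (x n, y n) \<in> sep_approx_solutions C Q A M pstar F G \<epsilon>"
proof -
  obtain e where "e \<longlonglongrightarrow> 0" and e: "\<And>n. infdist (x n) C \<le> e n \<and> infdist (y n) Q \<le> e n \<and>
      norm (y n - A (x n)) \<le> e n \<and> (\<forall>u\<in>C. F (p n) (x n) u \<ge> - e n) \<and>
      (\<forall>v\<in>Q. G (p n) (y n) v \<ge> - e n)"
    using assms(3) unfolding sep_gen_approx_seq_def by blast
  have "\<forall>\<^sub>F n in sequentially. dist (p n) pstar < \<epsilon>"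
    using assms(2,4) by (rule tendstoD)
  moreover have "\<forall>\<^sub>F n in sequentially. e n < \<epsilon>"
    using \<open>e \<longlonglongrightarrow> 0\<close> \<open>\<epsilon> > 0\<close> by (rule order_tendstoD(2))
  ultimately show ?thesis
  proof eventually_elim
    case (elim n)
    \<comment> \<open>The tolerance \<open>e n\<close> of the sequence does not control the distance
      from \<open>p n\<close> to \<open>pstar\<close>, so the maximum of the two is taken; both are
      eventually below \<epsilon>.\<close>
    have "(x n, y n) \<in> sep_approx_solutions C Q A M pstar F G (max (e n) (norm (p n - pstar)))"
      unfolding sep_approx_solutions_def using e[of n] assms(1)[of n]
      by clarify (intro bexI[of _ "p n"] conjI ballI; force)
    moreover have "max (e n) (norm (p n - pstar)) \<le> \<epsilon>"
      using elim by (simp add: dist_norm)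
    ultimately show ?case using sep_approx_solutions_mono by blast
  qed
qed

text \<open>Every condition defining a solution survives the limit: membership by closedness of
  \<open>C\<close> and \<open>Q\<close>, the equation by continuity of \<open>A\<close>, the
  inequalities by semi-continuity jointly in parameter and point, with the last argument
  fixed.\<close>

lemma sep_gen_approx_seq_limit:
  fixes C :: "'a::real_normed_vector set" and Q :: "'b::real_normed_vector set"
    and M :: "'n::real_normed_vector set"
  assumes C: "closed C" "C \<noteq> {}" and Q: "closed Q" "Q \<noteq> {}" and A: "bounded_linear A"
    and M: "pstar \<in> M" "\<And>n. p n \<in> M" "p \<longlonglongrightarrow> pstar"
    and F: "\<And>u. usc_on (M \<times> UNIV) (\<lambda>(p, z). F p z u)"
    and G: "\<And>v. usc_on (M \<times> UNIV) (\<lambda>(p, w). G p w v)"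
    and seq: "sep_gen_approx_seq F G C Q A p x y"
    and r: "strict_mono r" and lim: "(\<lambda>n. (x (r n), y (r n))) \<longlonglongrightarrow> l"
  shows "l \<in> sep_solutions (F pstar) (G pstar) C Q A"
proof -
  obtain z w where l: "l = (z, w)" by fastforce
  have x: "(\<lambda>n. x (r n)) \<longlonglongrightarrow> z" and y: "(\<lambda>n. y (r n)) \<longlonglongrightarrow> w"
    using tendsto_fst[OF lim] tendsto_snd[OF lim] by (simp_all add: l)
  have p: "(\<lambda>n. p (r n)) \<longlonglongrightarrow> pstar"
    using LIMSEQ_subseq_LIMSEQ[OF M(3) r] by (simp add: o_def)
  obtain e where "e \<longlonglongrightarrow> 0" and e: "\<And>n. infdist (x n) C \<le> e n \<and> infdist (y n) Q \<le> e n \<and>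
      norm (y n - A (x n)) \<le> e n \<and> (\<forall>u\<in>C. F (p n) (x n) u \<ge> - e n) \<and>
      (\<forall>v\<in>Q. G (p n) (y n) v \<ge> - e n)"
    using seq unfolding sep_gen_approx_seq_def by blast
  have er: "(\<lambda>n. e (r n)) \<longlonglongrightarrow> 0"
    using LIMSEQ_subseq_LIMSEQ[OF \<open>e \<longlonglongrightarrow> 0\<close> r] by (simp add: o_def)
  have "z \<in> C" using C x er e by (intro infdist_limit_in_closed[where e = "\<lambda>n. e (r n)"]) auto
  moreover have "w \<in> Q" using Q y er e by (intro infdist_limit_in_closed[where e = "\<lambda>n. e (r n)"]) auto
  moreover have "w = A z"
  proof -
    have "(\<lambda>n. y (r n) - A (x (r n))) \<longlonglongrightarrow> w - A z"
      by (intro tendsto_diff y bounded_linear.tendsto[OF A] x)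
    moreover have "(\<lambda>n. y (r n) - A (x (r n))) \<longlonglongrightarrow> 0"
      by (rule Lim_null_comparison[OF _ er]) (simp add: e)
    ultimately show ?thesis using LIMSEQ_unique by fastforce
  qed
  moreover have "F pstar z u \<ge> 0" if "u \<in> C" for u
    using usc_on_limit_ge[OF F[of u], of "(pstar, z)" "\<lambda>n. (p (r n), x (r n))" "\<lambda>n. e (r n)"]
      M er e that tendsto_Pair[OF p x] by simp
  moreover have "G pstar w v \<ge> 0" if "v \<in> Q" for v
    using usc_on_limit_ge[OF G[of v], of "(pstar, w)" "\<lambda>n. (p (r n), y (r n))" "\<lambda>n. e (r n)"]
      M er e that tendsto_Pair[OF p y] by simp
  ultimately show ?thesis unfolding l sep_solutions_def by simp
qed

section \<open>From well-posedness to finite covers\<close>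

text \<open>Well-posedness restated without parameters. The tolerances \<open>1 / Suc n\<close> are
  positive from \<open>n = 0\<close> on and tend to 0, so \<open>s\<close> is a generalized
  approximating sequence.\<close>

lemma sep_LP_well_posed_subseq:
  assumes "sep_LP_well_posed f g C Q A M pstar F G"
    and "\<And>n. s n \<in> sep_approx_solutions C Q A M pstar F G (1 / Suc n)"
  obtains r z where "strict_mono (r :: nat \<Rightarrow> nat)" "z \<in> sep_solutions f g C Q A" "(s \<circ> r) \<longlonglongrightarrow> z"
proof -
  have "(\<lambda>n. 1 / real (Suc n)) \<longlonglongrightarrow> 0"
    using LIMSEQ_Suc[OF lim_1_over_n] by simp
  moreover have "(fst (s n), snd (s n)) \<in> sep_approx_solutions C Q A M pstar F G (1 / Suc n)" for n
    using assms(2) by simp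
  ultimately obtain p where "\<And>n. p n \<in> M" "p \<longlonglongrightarrow> pstar"
    "sep_gen_approx_seq F G C Q A p (\<lambda>n. fst (s n)) (\<lambda>n. snd (s n))"
    by (rule sep_gen_approx_seq_if_in_approx_solutions[rotated]) auto
  then obtain r z where "strict_mono (r :: nat \<Rightarrow> nat)" "z \<in> sep_solutions f g C Q A"
    "(\<lambda>n. (fst (s (r n)), snd (s (r n)))) \<longlonglongrightarrow> z"
    using assms(1) unfolding sep_LP_well_posed_def by blast
  then show ?thesis by (intro that) (simp_all add: o_def)
qed

lemma sep_LP_well_posed_imp_ball_cover:
  fixes C :: "'a::real_normed_vector set" and Q :: "'b::real_normed_vector set"
  assumes wp: "sep_LP_well_posed (F pstar) (G pstar) C Q A M pstar F G"
    and "pstar \<in> M" "e > 0"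
  obtains K \<epsilon> where "finite K" "\<epsilon> > 0"
    "sep_approx_solutions C Q A M pstar F G \<epsilon> \<subseteq> (\<Union>x\<in>K. ball x e)"
proof -
  let ?S = "sep_solutions (F pstar) (G pstar) C Q A"
  let ?T = "sep_approx_solutions C Q A M pstar F G"
  \<comment> \<open>Solutions lie in every approximate solution set, so well-posedness applies to
    any sequence of solutions and puts a subsequential limit back in \<open>?S\<close>.\<close>
  have "seq_compact ?S"
    unfolding seq_compact_def
  proof (intro allI impI)
    fix s :: "nat \<Rightarrow> 'a \<times> 'b" assume "\<forall>n. s n \<in> ?S"
    then have "s n \<in> ?T (1 / Suc n)" for n
      by (intro subsetD[OF sep_solutions_subset_approx_solutions[OF \<open>pstar \<in> M\<close>]]) auto
    with wp show "\<exists>l\<in>?S. \<exists>r. strict_mono r \<and> (s \<circ> r) \<longlonglongrightarrow> l"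
      by (rule sep_LP_well_posed_subseq) blast
  qed
  from seq_compact_imp_totally_bounded[OF this] \<open>e > 0\<close>
  obtain K where K: "finite K" "?S \<subseteq> (\<Union>x\<in>K. ball x e)" by auto
  \<comment> \<open>Otherwise points of \<open>?T (1 / Suc n)\<close> outside the union would
    subconverge to a solution. The union is open and contains that solution, hence also a tail of
    the subsequence.\<close>
  have "\<exists>n. ?T (1 / Suc n) \<subseteq> (\<Union>x\<in>K. ball x e)"
  proof (rule ccontr)
    assume "\<not> ?thesis"
    then have "\<forall>n. \<exists>t. t \<in> ?T (1 / Suc n) \<and> t \<notin> (\<Union>x\<in>K. ball x e)" by blast
    then obtain s where s: "\<And>n. s n \<in> ?T (1 / Suc n)" "\<And>n. s n \<notin> (\<Union>x\<in>K. ball x e)"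
      by metis
    obtain r z where "z \<in> ?S" and lim: "(s \<circ> r) \<longlonglongrightarrow> z"
      using wp s(1) by (rule sep_LP_well_posed_subseq)
    with K(2) have "z \<in> (\<Union>x\<in>K. ball x e)" by blast
    then have "\<forall>\<^sub>F n in sequentially. (s \<circ> r) n \<in> (\<Union>x\<in>K. ball x e)"
      by (intro topological_tendstoD[OF lim] open_UN ballI open_ball)
    then show False using s(2) by simp
  qed
  then obtain n where "?T (1 / Suc n) \<subseteq> (\<Union>x\<in>K. ball x e)" ..
  with K(1) show ?thesis by (intro that[of K "1 / Suc n"]) simp_all
qed

section \<open>From vanishing measure to convergent subsequences\<close>

text \<open>For each radius \<open>e\<close> a single \<epsilon> with measure below \<open>e\<close>
  suffices: a tail of the sequence lies in that approximate solution set, which finitely many balls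
  of radius \<open>e\<close> cover. The product space is complete.\<close>

lemma sep_gen_approx_seq_subseq:
  fixes C :: "'a::banach set" and Q :: "'b::banach set"
  assumes \<mu>: "((\<lambda>\<epsilon>. kuratowski_measure (sep_approx_solutions C Q A M pstar F G \<epsilon>)) \<longlongrightarrow> 0) (at_right 0)"
    and p: "\<And>n. p n \<in> M" "p \<longlonglongrightarrow> pstar" and seq: "sep_gen_approx_seq F G C Q A p x y"
  obtains r l where "strict_mono (r :: nat \<Rightarrow> nat)" "(\<lambda>n. (x (r n), y (r n))) \<longlonglongrightarrow> l"
proof -
  let ?T = "sep_approx_solutions C Q A M pstar F G"
  have "\<exists>K. finite K \<and> (\<forall>\<^sub>F n in sequentially. (x n, y n) \<in> (\<Union>a\<in>K. ball a e))" if "e > 0" for e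
  proof -
    have "\<forall>\<^sub>F \<epsilon> in at_right 0. kuratowski_measure (?T \<epsilon>) < ereal e"
      using \<mu> \<open>e > 0\<close> by (intro order_tendstoD(2)) auto
    then obtain b where "b > 0" and b: "\<And>\<epsilon>. 0 < \<epsilon> \<Longrightarrow> \<epsilon> < b \<Longrightarrow> kuratowski_measure (?T \<epsilon>) < ereal e"
      unfolding eventually_at_right_field by auto
    obtain \<epsilon> where "0 < \<epsilon>" "\<epsilon> < b" using dense[OF \<open>b > 0\<close>] by blast
    from b[OF this] obtain K where K: "finite K" "?T \<epsilon> \<subseteq> (\<Union>a\<in>K. ball a e)"
      by (rule finite_ball_cover_if_kuratowski_measure_less)
    have "\<forall>\<^sub>F n in sequentially. (x n, y n) \<in> ?T \<epsilon>"
      using p seq \<open>\<epsilon> > 0\<close> by (rule in_approx_solutions_if_sep_gen_approx_seq)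
    then have "\<forall>\<^sub>F n in sequentially. (x n, y n) \<in> (\<Union>a\<in>K. ball a e)"
      by (rule eventually_mono) (rule subsetD[OF K(2)])
    with K(1) show ?thesis by blast
  qed
  then obtain r l where "strict_mono (r :: nat \<Rightarrow> nat)" "((\<lambda>n. (x n, y n)) \<circ> r) \<longlonglongrightarrow> l"
    by (rule convergent_subseq_if_eventually_ball_cover)
  then show ?thesis by (intro that) (simp_all add: o_def)
qed

section \<open>The equivalence of well-posedness and vanishing measure\<close>

theorem theorem7:
  fixes C :: "'a::banach set" and Q :: "'b::banach set"
    and A :: "'a \<Rightarrow> 'b"
    and f :: "'a \<Rightarrow> 'a \<Rightarrow> real" and g :: "'b \<Rightarrow> 'b \<Rightarrow> real"
    and pstar :: "'n::real_normed_vector" and r :: real and M :: "'n set"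
    and F :: "'n \<Rightarrow> 'a \<Rightarrow> 'a \<Rightarrow> real" and G :: "'n \<Rightarrow> 'b \<Rightarrow> 'b \<Rightarrow> real"
  assumes "C \<noteq> {}" and "closed C" and "convex C"
    and "Q \<noteq> {}" and "closed Q" and "convex Q"
    and "bounded_linear A"
    and finite_dim: "\<exists>B :: 'n set. finite B \<and> span B = UNIV"
    and "r > 0" and "M = cball pstar r"
    and "F pstar = f" and "G pstar = g"
    and "\<And>x. usc_on (M \<times> UNIV) (\<lambda>(p, z). F p z x)"
    and "\<And>y. usc_on (M \<times> UNIV) (\<lambda>(p, w). G p w y)"
  shows "sep_LP_well_posed f g C Q A M pstar F G \<longleftrightarrow>
    (\<forall>\<epsilon>>0. sep_approx_solutions C Q A M pstar F G \<epsilon> \<noteq> {}) \<and>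
    ((\<lambda>\<epsilon>. kuratowski_measure (sep_approx_solutions C Q A M pstar F G \<epsilon>)) \<longlongrightarrow> 0) (at_right 0)"
proof -
  let ?S = "sep_solutions f g C Q A"
  let ?T = "sep_approx_solutions C Q A M pstar F G"
  have "pstar \<in> M" using \<open>r > 0\<close> \<open>M = cball pstar r\<close> by simp
  note limit = sep_gen_approx_seq_limit[OF \<open>closed C\<close> \<open>C \<noteq> {}\<close> \<open>closed Q\<close> \<open>Q \<noteq> {}\<close>
      \<open>bounded_linear A\<close> \<open>pstar \<in> M\<close> _ _ assms(13,14), unfolded \<open>F pstar = f\<close> \<open>G pstar = g\<close>]
  show ?thesis
  proof (intro iffI conjI)
    assume wp: "sep_LP_well_posed f g C Q A M pstar F G"
    have "?S \<noteq> {}" using wp unfolding sep_LP_well_posed_def by blast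
    then show "\<forall>\<epsilon>>0. ?T \<epsilon> \<noteq> {}"
      using sep_solutions_subset_approx_solutions[OF \<open>pstar \<in> M\<close>, of _ F G C Q A]
        \<open>F pstar = f\<close> \<open>G pstar = g\<close> by (metis less_imp_le subset_empty)
    show "((\<lambda>\<epsilon>. kuratowski_measure (?T \<epsilon>)) \<longlongrightarrow> 0) (at_right 0)"
    proof (rule order_tendstoI)
      fix a :: ereal assume "a < 0"
      then show "\<forall>\<^sub>F \<epsilon> in at_right 0. a < kuratowski_measure (?T \<epsilon>)"
        by (intro always_eventually) (metis kuratowski_measure_nonneg less_le_trans)
    next
      fix a :: ereal assume "0 < a"
      \<comment> \<open>\<open>a\<close> may be infinite, so a real \<open>b\<close> is put below
        it. Balls of radius \<open>b / 3\<close> give measure at most \<open>b\<close> by the factor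
        3 in the cover bound.\<close>
      then obtain b where b: "0 < ereal b" "ereal b < a" using ereal_dense2 by blast
      obtain K \<epsilon> where K: "finite K" "\<epsilon> > 0" "?T \<epsilon> \<subseteq> (\<Union>x\<in>K. ball x (b / 3))"
        using sep_LP_well_posed_imp_ball_cover[of F pstar G C Q A M "b / 3"]
          wp \<open>pstar \<in> M\<close> b(1) \<open>F pstar = f\<close> \<open>G pstar = g\<close> by auto
      \<comment> \<open>By monotonicity the cover found for one \<epsilon> serves all smaller
        tolerances.\<close>
      have "kuratowski_measure (?T \<delta>) < a" if "\<delta> < \<epsilon>" for \<delta>
      proof -
        have "?T \<delta> \<subseteq> (\<Union>x\<in>K. ball x (b / 3))"
          using sep_approx_solutions_mono[OF less_imp_le[OF that]] K(3) by (rule order_trans)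
        then have "kuratowski_measure (?T \<delta>) \<le> ereal b"
          using kuratowski_measure_le_if_ball_cover[OF K(1), of "?T \<delta>" "b / 3"] b(1) by simp
        then show ?thesis using b(2) by (rule le_less_trans)
      qed
      then show "\<forall>\<^sub>F \<epsilon> in at_right 0. kuratowski_measure (?T \<epsilon>) < a"
        using K(2) unfolding eventually_at_right_field by (intro exI[of _ \<epsilon>]) simp
    qed
  next
    assume *: "(\<forall>\<epsilon>>0. ?T \<epsilon> \<noteq> {}) \<and>
      ((\<lambda>\<epsilon>. kuratowski_measure (?T \<epsilon>)) \<longlongrightarrow> 0) (at_right 0)"
    then have \<mu>: "((\<lambda>\<epsilon>. kuratowski_measure (?T \<epsilon>)) \<longlongrightarrow> 0) (at_right 0)" by blast
    have subseq: "\<exists>r z. strict_mono r \<and> z \<in> ?S \<and> (\<lambda>n. (x (r n), y (r n))) \<longlonglongrightarrow> z"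
      if approx: "\<And>n. p n \<in> M" "p \<longlonglongrightarrow> pstar" "sep_gen_approx_seq F G C Q A p x y" for p x y
    proof -
      obtain r l where "strict_mono (r :: nat \<Rightarrow> nat)" "(\<lambda>n. (x (r n), y (r n))) \<longlonglongrightarrow> l"
        using \<mu> approx by (rule sep_gen_approx_seq_subseq)
      with limit[OF approx, OF this] show ?thesis by (intro exI[of _ r] exI[of _ l] conjI)
    qed
    \<comment> \<open>A solution is produced as a limit: points picked from these nonempty sets form
      a generalized approximating sequence, to which \<open>subseq\<close> applies.\<close>
    have "?T (1 / Suc n) \<noteq> {}" for n using conjunct1[OF *] by simp
    then have "\<forall>n. \<exists>t. t \<in> ?T (1 / Suc n)" by blast
    then obtain s where "\<And>n. s n \<in> ?T (1 / Suc n)" by metis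
    then have "(fst (s n), snd (s n)) \<in> ?T (1 / Suc n)" for n by simp
    with LIMSEQ_Suc[OF lim_1_over_n] obtain p where "\<And>n. p n \<in> M" "p \<longlonglongrightarrow> pstar"
      "sep_gen_approx_seq F G C Q A p (\<lambda>n. fst (s n)) (\<lambda>n. snd (s n))"
      by (rule sep_gen_approx_seq_if_in_approx_solutions[rotated]) auto
    then have "?S \<noteq> {}" using subseq[of p "\<lambda>n. fst (s n)" "\<lambda>n. snd (s n)"] by auto
    then show "sep_LP_well_posed f g C Q A M pstar F G"
      unfolding sep_LP_well_posed_def by (intro conjI allI impI subseq) simp_all
  qed
qed

end
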